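(* Let $G$ be a connected graph of order $n$ and let $q\in\{2,\dots,n-1\}$. Then the largest eigenvalue $\partial_1^S$ of the distance Seidel matrix $\mathcal{D}^S(G)$ equals $3$ and has multiplicity exactly $n-q$ if and only if $G$ is a complete $q$-partite graph $K_{n_1,\dots,n_q}$ (with $n_1+\cdots+n_q=n$, all $n_i\ge1$).
   Context: For a connected simple graph $G$ on vertices $v_1,\dots,v_n$ with distance matrix $\mathcal{D}(G)=(d_G(v_r,v_t))$, the distance Seidel matrix is $\mathcal{D}^S(G)=J-I-2\mathcal{D}(G)$, $J$ the all-ones matrix. Its eigenvalues are $\partial_1^S\ge\cdots\ge\partial_n^S$. The complete $q$-partite graph $K_{n_1,\dots,n_q}$ has vertex set partitioned into $q$ nonempty independent sets of sizes $n_1,\dots,n_q$, with two vertices adjacent iff they lie in different parts. *)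

theory Defs
  imports
    "HOL-Library.Disjoint_Sets"
    "Graph_Theory.Graph_Theory"
    "Jordan_Normal_Form.Spectral_Radius"
begin

text \<open>Simple graphs are the locale \<^locale>\<open>graph\<close>: a finite digraph without loops and parallel arcs,
  in which every arc has a reverse arc. An undirected edge is thus a pair of opposite arcs.\<close>

text \<open>The cost of a walk under unit weights is its number of arcs. The infimum is taken in the
  extended reals; in a connected graph it is finite, so nothing is lost in the conversion.\<close>

definition graph_dist :: "('a, 'b) pre_digraph \<Rightarrow> 'a \<Rightarrow> 'a \<Rightarrow> real" where
  "graph_dist G u v = real_of_ereal (wf_digraph.\<mu> G (\<lambda>_. 1) u v)"

text \<open>The list \<open>vs\<close> is an enumeration of the vertices without repetition, and fixes the indexing of
  rows and columns.\<close>

definition distance_matrix :: "('a, 'b) pre_digraph \<Rightarrow> 'a list \<Rightarrow> real mat" where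
  "distance_matrix G vs =
     mat (length vs) (length vs) (\<lambda>(r, t). graph_dist G (vs ! r) (vs ! t))"

definition all_ones_mat :: "nat \<Rightarrow> real mat" where
  "all_ones_mat n = mat n n (\<lambda>_. 1)"

definition distance_seidel_matrix :: "('a, 'b) pre_digraph \<Rightarrow> 'a list \<Rightarrow> real mat" where
  "distance_seidel_matrix G vs =
     all_ones_mat (length vs) - 1\<^sub>m (length vs) - 2 \<cdot>\<^sub>m distance_matrix G vs"

text \<open>Meant for symmetric real matrices of positive dimension: all their eigenvalues are real, so the
  spectrum over the reals is finite, nonempty and complete.\<close>

definition largest_eigenvalue :: "real mat \<Rightarrow> real" where
  "largest_eigenvalue A = Max (spectrum A)"

definition eigenvalue_multiplicity :: "real mat \<Rightarrow> real \<Rightarrow> nat" where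
  "eigenvalue_multiplicity A k = Polynomial.order k (char_poly A)"

text \<open>The complete multipartite graph with part sizes \<open>ns\<close>, in the style of
  \<^const>\<open>complete_bipartite_digraph\<close>. The parts are indexed by the positions in \<open>ns\<close>.\<close>

definition complete_multipartite_digraph :: "nat list \<Rightarrow> ('a, 'b) pre_digraph \<Rightarrow> bool" where
  "complete_multipartite_digraph ns G \<longleftrightarrow> graph G \<and>
     (\<exists>V :: nat \<Rightarrow> 'a set.
        verts G = (\<Union>i<length ns. V i) \<and>
        disjoint_family_on V {..<length ns} \<and>
        (\<forall>i<length ns. V i \<noteq> {} \<and> card (V i) = ns ! i) \<and>
        arcs_ends G =
          {(u, v). \<exists>i<length ns. \<exists>j<length ns. i \<noteq> j \<and> u \<in> V i \<and> v \<in> V j})"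

end

theory Submission
  imports Defs "HOL-Analysis.Function_Topology"
begin

text \<open>Put \<open>M = 3 I - D\<close> for the distance Seidel matrix \<open>D\<close>. Its diagonal entries are \<open>3\<close>, and its
  entry at two distinct vertices at distance \<open>d\<close> is \<open>2 d - 1\<close>.

  For a complete multipartite graph, \<open>M = X Y\<close> with the vertex-part incidence matrix \<open>X\<close> and \<open>Y X\<close>
  invertible of size \<open>q\<close>, so comparing the determinants of \<open>x I + X Y\<close> and \<open>x I + Y X\<close> gives \<open>3\<close> the
  multiplicity \<open>n - q\<close>; as \<open>M\<close> is positive semidefinite, no eigenvalue of \<open>D\<close> exceeds \<open>3\<close>.

  Conversely, if \<open>3\<close> is the largest eigenvalue, then \<open>M\<close> is positive semidefinite. Evaluating the form
  at \<open>e\<^sub>r - e\<^sub>t\<close> shows that distances are at most \<open>2\<close>, and at distance \<open>2\<close> the form vanishes, so that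
  \<open>e\<^sub>r - e\<^sub>t\<close> is in the kernel and the columns \<open>r\<close> and \<open>t\<close> of \<open>M\<close> agree. Hence nonadjacent vertices have
  the same neighbours, which makes the graph complete \<open>p\<close>-partite for some \<open>p\<close>, and the multiplicity
  yields \<open>p = q\<close>.\<close>

section \<open>Quadratic forms of real symmetric matrices\<close>

lemma scalar_prod_self_nonneg:
  fixes v :: "real vec"
  shows "0 \<le> v \<bullet> v"
  by (simp add: scalar_prod_def sum_nonneg)

lemma scalar_prod_self_eq_0_iff:
  fixes v :: "real vec"
  assumes "v \<in> carrier_vec n"
  shows "v \<bullet> v = 0 \<longleftrightarrow> v = 0\<^sub>v n"
proof
  assume "v \<bullet> v = 0"
  then show "v = 0\<^sub>v n"
    using assms by (intro eq_vecI) (auto simp: scalar_prod_def sum_nonneg_eq_0_iff)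
qed (use assms in auto)

lemma smult_one_minus_mult_mat_vec:
  fixes A :: "'a :: comm_ring_1 mat"
  assumes "A \<in> carrier_mat n n" "v \<in> carrier_vec n"
  shows "(k \<cdot>\<^sub>m 1\<^sub>m n - A) *\<^sub>v v = k \<cdot>\<^sub>v v - A *\<^sub>v v"
proof -
  have "k \<cdot>\<^sub>m 1\<^sub>m n *\<^sub>v v = k \<cdot>\<^sub>v v"
    using assms by (intro eq_vecI) auto
  then show ?thesis
    using assms by (simp add: minus_mult_distrib_mat_vec[of _ n n])
qed

lemma transpose_mat_symmetric_entry:
  assumes "A\<^sup>T = A" "i < dim_row A" "j < dim_col A"
  shows "A $$ (j, i) = A $$ (i, j)"
  using assms by (metis index_transpose_mat(1))

lemma symmetric_mat_scalar_prod:
  fixes A :: "'a :: comm_semiring_0 mat"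
  assumes "A \<in> carrier_mat n n" "A\<^sup>T = A" "x \<in> carrier_vec n" "y \<in> carrier_vec n"
  shows "x \<bullet> (A *\<^sub>v y) = y \<bullet> (A *\<^sub>v x)"
proof -
  have "x \<bullet> (A *\<^sub>v y) = (A *\<^sub>v x) \<bullet> y"
    using transpose_vec_mult_scalar[of A n n y x] assms by simp
  also have "\<dots> = y \<bullet> (A *\<^sub>v x)"
    using assms by (metis comm_scalar_prod mult_mat_vec_carrier)
  finally show ?thesis .
qed

lemma quadratic_form_diff:
  fixes M :: "real mat"
  assumes M: "M \<in> carrier_mat n n" "M\<^sup>T = M" and x: "x \<in> carrier_vec n" and y: "y \<in> carrier_vec n"
  shows "(x - t \<cdot>\<^sub>v y) \<bullet> (M *\<^sub>v (x - t \<cdot>\<^sub>v y)) =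
    x \<bullet> (M *\<^sub>v x) - 2 * t * (y \<bullet> (M *\<^sub>v x)) + t\<^sup>2 * (y \<bullet> (M *\<^sub>v y))"
proof -
  have "M *\<^sub>v (x - t \<cdot>\<^sub>v y) = M *\<^sub>v x - t \<cdot>\<^sub>v (M *\<^sub>v y)"
    using M x y by (simp add: mult_minus_distrib_mat_vec mult_mat_vec)
  moreover have "x \<bullet> (M *\<^sub>v y) = y \<bullet> (M *\<^sub>v x)"
    using symmetric_mat_scalar_prod M x y by blast
  ultimately show ?thesis
    using M x y
    by (simp add: minus_scalar_prod_distrib[of _ n] scalar_prod_minus_distrib[of _ n]
        power2_eq_square algebra_simps)
qed

text \<open>Perturbing \<open>x\<close> in the direction of \<open>M x\<close> lowers the form to first order.\<close>

lemma psd_quadratic_form_zero_imp_kernel: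
  fixes M :: "real mat"
  assumes M: "M \<in> carrier_mat n n" "M\<^sup>T = M"
    and psd: "\<And>v. v \<in> carrier_vec n \<Longrightarrow> 0 \<le> v \<bullet> (M *\<^sub>v v)"
    and x: "x \<in> carrier_vec n" and zero: "x \<bullet> (M *\<^sub>v x) = 0"
  shows "M *\<^sub>v x = 0\<^sub>v n"
proof -
  define y where "y = M *\<^sub>v x"
  have y: "y \<in> carrier_vec n" using M x by (simp add: y_def)
  define a c where "a = y \<bullet> y" and "c = y \<bullet> (M *\<^sub>v y)"
  have a: "0 \<le> a" and c: "0 \<le> c"
    unfolding a_def c_def using scalar_prod_self_nonneg psd[OF y] by auto
  \<comment> \<open>The form at \<open>x - t y\<close> is \<open>t^2 c - 2 t a\<close>. Its
    minimiser would be \<open>a / c\<close>; the added 1 keeps the denominator positive when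
    \<open>c = 0\<close> and still makes the value negative unless \<open>a = 0\<close>.\<close>
  define t where "t = a / (c + 1)"
  have a_eq: "a = t * (c + 1)" using c by (simp add: t_def)
  have "0 \<le> (x - t \<cdot>\<^sub>v y) \<bullet> (M *\<^sub>v (x - t \<cdot>\<^sub>v y))" using x y by (intro psd) simp
  also have "\<dots> = - 2 * t * a + t\<^sup>2 * c"
    using quadratic_form_diff[OF M x y] zero by (simp add: a_def c_def y_def)
  also have "\<dots> = - (t\<^sup>2 * (c + 2))"
    unfolding a_eq by (simp add: power2_eq_square algebra_simps)
  finally have "t\<^sup>2 * (c + 2) \<le> 0" by simp
  then have "t = 0" using c by (simp add: mult_le_0_iff)
  then have "a = 0" using a_eq by simp
  then show ?thesis
    using scalar_prod_self_eq_0_iff[OF y] by (simp add: a_def y_def)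
qed

section \<open>The Rayleigh bound for symmetric matrices\<close>

lemma compact_unit_sphere_fun:
  "compact {x :: nat \<Rightarrow> real. (\<forall>i\<ge>n. x i = 0) \<and> (\<Sum>i<n. (x i)\<^sup>2) = 1}"
proof -
  \<comment> \<open>Functions vanishing from \<open>n\<close> on stand for vectors of the variable
    dimension \<open>n\<close>; the factors \<open>{0}\<close> enforce this. The product is compact
    by Tychonoff, and the sphere is a closed subset of it.\<close>
  define S where "S i = (if i < n then {-1..1} else {0 :: real})" for i
  have "compact (PiE UNIV S)"
    using compactin_PiE[of "\<lambda>_. euclidean" UNIV S]
    by (simp add: euclidean_product_topology S_def)
  moreover have "closed {x :: nat \<Rightarrow> real. (\<Sum>i<n. (x i)\<^sup>2) = 1}"
    by (intro closed_Collect_eq continuous_intros continuous_on_product_coordinates)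
  ultimately have "compact (PiE UNIV S \<inter> {x. (\<Sum>i<n. (x i)\<^sup>2) = 1})"
    by (rule compact_Int_closed)
  also have "PiE UNIV S \<inter> {x. (\<Sum>i<n. (x i)\<^sup>2) = 1} =
      {x. (\<forall>i\<ge>n. x i = 0) \<and> (\<Sum>i<n. (x i)\<^sup>2) = 1}"
  proof -
    have "-1 \<le> x i \<and> x i \<le> 1" if "(\<Sum>i<n. (x i)\<^sup>2) = 1" "i < n" for x :: "nat \<Rightarrow> real" and i
    proof -
      have "(x i)\<^sup>2 \<le> (\<Sum>i<n. (x i)\<^sup>2)"
        using that by (intro member_le_sum) auto
      then have "\<bar>x i\<bar> \<le> 1"
        using that by (simp add: abs_square_le_1)
      then show ?thesis by auto
    qed
    then show ?thesis
      by (auto simp: S_def PiE_def Pi_def split: if_splits)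
  qed
  finally show ?thesis .
qed

text \<open>The form attains a maximum \<open>k\<close> on the compact unit sphere, and by
  homogeneity \<open>k\<close> bounds it everywhere. So \<open>k I - A\<close> is positive
  semidefinite and its form vanishes at the maximiser, which therefore lies in its kernel and is an
  eigenvector for \<open>k\<close>.\<close>

lemma symmetric_mat_rayleigh:
  fixes A :: "real mat"
  assumes A: "A \<in> carrier_mat n n" "A\<^sup>T = A" and n: "0 < n"
  obtains k where "eigenvalue A k" "\<And>v. v \<in> carrier_vec n \<Longrightarrow> v \<bullet> (A *\<^sub>v v) \<le> k * (v \<bullet> v)"
proof -
  define S where "S = {x :: nat \<Rightarrow> real. (\<forall>i\<ge>n. x i = 0) \<and> (\<Sum>i<n. (x i)\<^sup>2) = 1}"
  define Q where "Q x = vec n x \<bullet> (A *\<^sub>v vec n x)" for x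
  have Q_eq: "Q x = (\<Sum>i<n. x i * (\<Sum>j<n. A $$ (i, j) * x j))" for x
    using A by (simp add: Q_def scalar_prod_def lessThan_atLeast0)
  have norm_eq: "vec n x \<bullet> vec n x = (\<Sum>i<n. (x i)\<^sup>2)" for x :: "nat \<Rightarrow> real"
    by (simp add: scalar_prod_def lessThan_atLeast0 power2_eq_square)
  have "compact S" unfolding S_def by (rule compact_unit_sphere_fun)
  \<comment> \<open>The first unit vector, available because \<open>0 < n\<close>, shows that the
    sphere is nonempty.\<close>
  moreover have "(\<lambda>i. if i = 0 then 1 else 0) \<in> S"
    using n by (auto simp: S_def if_distrib[of "\<lambda>x. x\<^sup>2"] cong: if_cong)
  moreover have "continuous_on S Q"
    unfolding Q_eq
    by (intro continuous_intros continuous_on_subset[OF continuous_on_product_coordinates]) auto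
  ultimately obtain x where x: "x \<in> S" and max: "\<And>y. y \<in> S \<Longrightarrow> Q y \<le> Q x"
    using continuous_attains_sup[of S Q] by blast
  define k where "k = Q x"
  have bound: "v \<bullet> (A *\<^sub>v v) \<le> k * (v \<bullet> v)" if v: "v \<in> carrier_vec n" for v
  proof (cases "v \<bullet> v = 0")
    case True
    then have "v = 0\<^sub>v n" using scalar_prod_self_eq_0_iff v by blast
    then show ?thesis using A by simp
  next
    case False
    define s where "s = v \<bullet> v"
    have s: "0 < s" using False scalar_prod_self_nonneg[of v] by (simp add: s_def)
    define y where "y i = (if i < n then v $ i / sqrt s else 0)" for i
    have vec_y: "vec n y = (1 / sqrt s) \<cdot>\<^sub>v v"
      using v by (intro eq_vecI) (auto simp: y_def)
    have "vec n y \<bullet> vec n y = 1"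
      using v s by (simp add: vec_y s_def[symmetric] real_sqrt_mult[symmetric])
    then have "y \<in> S" by (simp add: S_def norm_eq) (simp add: y_def)
    then have "Q y \<le> k" using max by (simp add: k_def)
    moreover have "Q y = v \<bullet> (A *\<^sub>v v) / s"
      using v A s by (simp add: Q_def vec_y mult_mat_vec real_sqrt_mult[symmetric])
    ultimately show ?thesis using s by (simp add: s_def field_simps)
  qed
  define M where "M = k \<cdot>\<^sub>m 1\<^sub>m n - A"
  have M: "M \<in> carrier_mat n n" "M\<^sup>T = M"
    using A transpose_mat_symmetric_entry[OF A(2)] by (auto simp: M_def intro!: eq_matI)
  have Mv: "M *\<^sub>v v = k \<cdot>\<^sub>v v - A *\<^sub>v v" if "v \<in> carrier_vec n" for v
    using that A by (simp add: M_def smult_one_minus_mult_mat_vec)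
  have "M *\<^sub>v vec n x = 0\<^sub>v n"
  proof (rule psd_quadratic_form_zero_imp_kernel[OF M])
    show "0 \<le> v \<bullet> (M *\<^sub>v v)" if "v \<in> carrier_vec n" for v
      using bound[OF that] that A by (simp add: Mv scalar_prod_minus_distrib[of _ n])
    show "vec n x \<bullet> (M *\<^sub>v vec n x) = 0"
      using x A by (simp add: Mv scalar_prod_minus_distrib[of _ n] norm_eq S_def k_def Q_def[symmetric])
  qed simp
  then have "A *\<^sub>v vec n x = k \<cdot>\<^sub>v vec n x"
    using A by (auto simp: Mv vec_eq_iff)
  moreover have "vec n x \<noteq> 0\<^sub>v n"
    using x by (auto simp: S_def norm_eq[symmetric])
  ultimately have "eigenvalue A k"
    using A unfolding eigenvalue_def eigenvector_def by (intro exI[of _ "vec n x"]) auto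
  then show thesis using bound that by blast
qed

text \<open>The eigenvalue that bounds the form lies in the finite spectrum, hence is at most its
  \<open>Max\<close>. In dimension 0 the spectrum is empty and \<open>Max\<close> unspecified, but
  both sides are 0.\<close>

lemma largest_eigenvalue_rayleigh:
  assumes A: "A \<in> carrier_mat n n" "A\<^sup>T = A" and v: "v \<in> carrier_vec n"
  shows "v \<bullet> (A *\<^sub>v v) \<le> largest_eigenvalue A * (v \<bullet> v)"
proof (cases "n = 0")
  case False
  then obtain k where "eigenvalue A k" and k: "v \<bullet> (A *\<^sub>v v) \<le> k * (v \<bullet> v)"
    using symmetric_mat_rayleigh[OF A] v by (metis neq0_conv)
  then have "k \<le> largest_eigenvalue A"
    unfolding largest_eigenvalue_def
    using card_finite_spectrum(1)[OF A(1)] by (intro Max_ge) (auto simp: spectrum_def)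
  then show ?thesis
    using k scalar_prod_self_nonneg[of v] by (meson mult_right_mono order_trans)
qed (use A v in \<open>simp add: scalar_prod_def\<close>)

section \<open>Entries of positive semidefinite matrices\<close>

lemma quadratic_form_unit_diff:
  fixes M :: "real mat"
  assumes M: "M \<in> carrier_mat n n" "M\<^sup>T = M" and r: "r < n" and t: "t < n"
  shows "(unit_vec n r - unit_vec n t) \<bullet> (M *\<^sub>v (unit_vec n r - unit_vec n t)) =
    M $$ (r, r) - 2 * M $$ (t, r) + M $$ (t, t)"
proof -
  have "M *\<^sub>v unit_vec n j = col M j" if "j < n" for j
    using M that by (intro eq_vecI) auto
  then show ?thesis
    using quadratic_form_diff[OF M, of "unit_vec n r" "unit_vec n t" 1] M r t by simp
qed

text \<open>Nonnegativity of the form at a difference of two unit vectors. With all diagonal entries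
  3 it caps every entry at 3.\<close>

lemma psd_offdiag_le:
  fixes M :: "real mat"
  assumes M: "M \<in> carrier_mat n n" "M\<^sup>T = M"
    and psd: "\<And>v. v \<in> carrier_vec n \<Longrightarrow> 0 \<le> v \<bullet> (M *\<^sub>v v)"
    and "r < n" "t < n"
  shows "2 * M $$ (t, r) \<le> M $$ (r, r) + M $$ (t, t)"
  using psd[of "unit_vec n r - unit_vec n t"] quadratic_form_unit_diff[OF M] assms(4,5) by simp

text \<open>The equality case of the previous bound: the form vanishes at the difference of the unit
  vectors, which then lies in the kernel.\<close>

lemma psd_offdiag_eq_imp_equal_columns:
  fixes M :: "real mat"
  assumes M: "M \<in> carrier_mat n n" "M\<^sup>T = M"
    and psd: "\<And>v. v \<in> carrier_vec n \<Longrightarrow> 0 \<le> v \<bullet> (M *\<^sub>v v)"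
    and r: "r < n" and t: "t < n" and eq: "2 * M $$ (t, r) = M $$ (r, r) + M $$ (t, t)"
    and s: "s < n"
  shows "M $$ (s, r) = M $$ (s, t)"
proof -
  have "M *\<^sub>v (unit_vec n r - unit_vec n t) = 0\<^sub>v n"
    using quadratic_form_unit_diff[OF M r t] eq
    by (intro psd_quadratic_form_zero_imp_kernel[OF M psd]) auto
  then have "row M s \<bullet> (unit_vec n r - unit_vec n t) = 0"
    using M s by (metis carrier_matD(1) index_mult_mat_vec index_zero_vec(1))
  then show ?thesis
    using M r t s by (simp add: scalar_prod_minus_distrib[of _ n])
qed

section \<open>The matrix of a partition\<close>

text \<open>Both \<open>N * R\<close> and \<open>L * N\<close> are block upper triangular, so the
  determinant of \<open>N\<close> can be read off in two ways. The powers of \<open>a\<close>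
  replace a division by \<open>a\<close>, so the identity applies to polynomial matrices.\<close>

lemma det_smult_one_add_mult:
  fixes X Y :: "'a :: idom mat"
  assumes X: "X \<in> carrier_mat n p" and Y: "Y \<in> carrier_mat p n"
  shows "a ^ p * det (a \<cdot>\<^sub>m 1\<^sub>m n + X * Y) = a ^ n * det (a \<cdot>\<^sub>m 1\<^sub>m p + Y * X)"
proof -
  define N where "N = four_block_mat (a \<cdot>\<^sub>m 1\<^sub>m n) (- X) Y (1\<^sub>m p)"
  define L where "L = four_block_mat (1\<^sub>m n) (0\<^sub>m n p) (- Y) (a \<cdot>\<^sub>m 1\<^sub>m p)"
  define R where "R = four_block_mat (1\<^sub>m n) (0\<^sub>m n p) (- Y) (1\<^sub>m p)"
  have carrier: "N \<in> carrier_mat (n + p) (n + p)" "L \<in> carrier_mat (n + p) (n + p)"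
    "R \<in> carrier_mat (n + p) (n + p)"
    unfolding N_def L_def R_def by (intro four_block_carrier_mat; simp)+
  have "N * R = four_block_mat (a \<cdot>\<^sub>m 1\<^sub>m n + X * Y) (- X) (0\<^sub>m p n) (1\<^sub>m p)"
    unfolding N_def R_def
    using X Y by (subst mult_four_block_mat[of _ n n _ p _ p _ _ n _ p])
      (auto intro!: arg_cong4[of _ _ _ _ _ _ _ _ four_block_mat] simp: uminus_l_inv_mat)
  moreover have "det (four_block_mat (a \<cdot>\<^sub>m 1\<^sub>m n + X * Y) (- X) (0\<^sub>m p n) (1\<^sub>m p))
      = det (a \<cdot>\<^sub>m 1\<^sub>m n + X * Y)"
    using X Y by (subst det_four_block_mat_lower_left_zero[of _ n _ p]) auto
  moreover have "det R = 1"
    unfolding R_def using Y by (subst det_four_block_mat_upper_right_zero[of _ n _ p]) auto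
  ultimately have det_N: "det N = det (a \<cdot>\<^sub>m 1\<^sub>m n + X * Y)"
    using det_mult[OF carrier(1,3)] by simp
  have "L * N = four_block_mat (a \<cdot>\<^sub>m 1\<^sub>m n) (- X) (0\<^sub>m p n) (a \<cdot>\<^sub>m 1\<^sub>m p + Y * X)"
  proof -
    have "- Y * (a \<cdot>\<^sub>m 1\<^sub>m n) + a \<cdot>\<^sub>m 1\<^sub>m p * Y = 0\<^sub>m p n"
      using Y by (auto intro!: eq_matI)
    moreover have "- Y * - X + a \<cdot>\<^sub>m 1\<^sub>m p * 1\<^sub>m p = a \<cdot>\<^sub>m 1\<^sub>m p + Y * X"
      using X Y by (auto simp: comm_add_mat[of _ p p])
    ultimately show ?thesis
      unfolding N_def L_def
      using X Y by (subst mult_four_block_mat[of _ n n _ p _ p _ _ n _ p]) auto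
  qed
  moreover have "det (four_block_mat (a \<cdot>\<^sub>m 1\<^sub>m n) (- X) (0\<^sub>m p n) (a \<cdot>\<^sub>m 1\<^sub>m p + Y * X))
      = a ^ n * det (a \<cdot>\<^sub>m 1\<^sub>m p + Y * X)"
    using X Y by (subst det_four_block_mat_lower_left_zero[of _ n _ p]) auto
  moreover have "det L = a ^ p"
    unfolding L_def using Y by (subst det_four_block_mat_upper_right_zero[of _ n _ p]) auto
  ultimately show ?thesis
    using det_mult[OF carrier(2,1)] det_N by simp
qed

text \<open>With \<open>l = x - k\<close> the characteristic matrix is \<open>l I + X Y\<close>. The
  determinant identity gives \<open>l^p\<close> times the characteristic polynomial as
  \<open>l^n r\<close>, and \<open>r\<close> takes the nonzero value \<open>det (Y * X)\<close> at
  \<open>k\<close>; comparing orders at \<open>k\<close> gives the count.\<close>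

lemma order_char_poly_minus_mult:
  fixes X Y :: "'a :: field mat"
  assumes X: "X \<in> carrier_mat n p" and Y: "Y \<in> carrier_mat p n" and det: "det (Y * X) \<noteq> 0"
  shows "Polynomial.order k (char_poly (k \<cdot>\<^sub>m 1\<^sub>m n - X * Y)) + p = n"
proof -
  define A where "A = k \<cdot>\<^sub>m 1\<^sub>m n - X * Y"
  define X' Y' where "X' = map_mat (\<lambda>a. [:a:]) X" and "Y' = map_mat (\<lambda>a. [:a:]) Y"
  define l where "l = [:- k, 1:]"
  define r where "r = det (l \<cdot>\<^sub>m 1\<^sub>m p + Y' * X')"
  interpret const: comm_ring_hom "\<lambda>a :: 'a. [:a:]"
    by unfold_locales auto
  have X': "X' \<in> carrier_mat n p" and Y': "Y' \<in> carrier_mat p n"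
    using X Y by (auto simp: X'_def Y'_def)
  have prods: "X' * Y' = map_mat (\<lambda>a. [:a:]) (X * Y)" "Y' * X' = map_mat (\<lambda>a. [:a:]) (Y * X)"
    unfolding X'_def Y'_def
    using const.mat_hom_mult[OF X Y] const.mat_hom_mult[OF Y X] by simp_all
  have "char_poly_matrix A = l \<cdot>\<^sub>m 1\<^sub>m n + X' * Y'"
    unfolding prods using X Y by (intro eq_matI) (auto simp: char_poly_matrix_def A_def l_def)
  then have eq: "l ^ p * char_poly A = l ^ n * r"
    using det_smult_one_add_mult[OF X' Y', of l] by (simp add: char_poly_def r_def)
  have "poly r k = det (Y * X)"
    unfolding r_def prods
    using X Y by (intro poly_det_cong[of _ p]) (auto simp: l_def)
  then have r: "Polynomial.order k r = 0" "r \<noteq> 0"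
    using det by (auto intro: order_0I)
  have l: "l \<noteq> 0" by (simp add: l_def)
  have l_order: "Polynomial.order k (l ^ i) = i" for i
    unfolding l_def by (rule order_power_n_n)
  have "l ^ n * r \<noteq> 0" using l r by simp
  then have "char_poly A \<noteq> 0"
    using eq by auto
  then have "p + Polynomial.order k (char_poly A) = n"
    using arg_cong[OF eq, of "Polynomial.order k"] l r
    by (simp add: order_mult l_order)
  then show ?thesis by (simp add: A_def)
qed

text \<open>After expanding the squares and exchanging sums, a pair \<open>r\<close>,
  \<open>t\<close> contributes only at \<open>j = c r\<close>, and only if \<open>c t\<close> is the
  same class.\<close>

lemma sum_indicator_class:
  fixes f :: "'i \<Rightarrow> real"
  assumes "c ` I \<subseteq> J" "finite J" "finite I"
  shows "(\<Sum>j\<in>J. (\<Sum>r\<in>I. of_bool (c r = j) * f r)\<^sup>2) = (\<Sum>r\<in>I. \<Sum>t\<in>I. of_bool (c r = c t) * (f r * f t))"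
proof -
  have "(\<Sum>j\<in>J. (\<Sum>r\<in>I. of_bool (c r = j) * f r)\<^sup>2) =
      (\<Sum>j\<in>J. \<Sum>r\<in>I. \<Sum>t\<in>I. of_bool (c r = j) * of_bool (c t = j) * (f r * f t))"
    by (simp add: power2_eq_square sum_product mult_ac)
  also have "\<dots> = (\<Sum>r\<in>I. \<Sum>t\<in>I. \<Sum>j\<in>J. of_bool (c r = j) * of_bool (c t = j) * (f r * f t))"
    by (subst sum.swap, rule sum.cong[OF refl], subst sum.swap, rule refl)
  also have "\<dots> = (\<Sum>r\<in>I. \<Sum>t\<in>I. of_bool (c r = c t) * (f r * f t))"
  proof (intro sum.cong refl)
    fix r t assume "r \<in> I" "t \<in> I"
    then have "(\<Sum>j\<in>J. of_bool (c r = j) * of_bool (c t = j) * (f r * f t)) =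
        (\<Sum>j\<in>J. if j = c r then of_bool (c r = c t) * (f r * f t) else 0)"
      by (intro sum.cong) auto
    then show "(\<Sum>j\<in>J. of_bool (c r = j) * of_bool (c t = j) * (f r * f t)) =
        of_bool (c r = c t) * (f r * f t)"
      using assms \<open>r \<in> I\<close> by auto
  qed
  finally show ?thesis .
qed

section \<open>The class matrix and its spectrum\<close>

text \<open>This is \<open>3 I - D\<close> for the distance Seidel matrix \<open>D\<close> of a
  complete multipartite graph, where \<open>c\<close> sends an index to its part.\<close>

definition class_mat :: "nat \<Rightarrow> (nat \<Rightarrow> nat) \<Rightarrow> real mat" where
  "class_mat n c = mat n n (\<lambda>(r, t). if c r = c t then 3 else 1)"

lemma class_mat_carrier [simp]: "class_mat n c \<in> carrier_mat n n"
  by (simp add: class_mat_def)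

text \<open>The form is the square of the total sum of \<open>v\<close> plus twice the sum of the
  squares of its class sums.\<close>

lemma class_mat_psd:
  assumes "v \<in> carrier_vec n"
  shows "0 \<le> v \<bullet> (class_mat n c *\<^sub>v v)"
proof -
  have "v \<bullet> (class_mat n c *\<^sub>v v) =
      (\<Sum>r<n. \<Sum>t<n. (1 + 2 * of_bool (c r = c t)) * (v $ r * v $ t))"
    using assms by (simp add: scalar_prod_def class_mat_def lessThan_atLeast0 sum_distrib_left)
      (intro sum.cong refl, auto)
  also have "\<dots> = (\<Sum>r<n. v $ r)\<^sup>2 + 2 * (\<Sum>j\<in>c ` {..<n}. (\<Sum>r<n. of_bool (c r = j) * v $ r)\<^sup>2)"
    by (subst sum_indicator_class)
      (simp_all add: distrib_right distrib_left sum.distrib power2_eq_square sum_product sum_distrib_left mult_ac)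
  also have "\<dots> \<ge> 0" by (intro add_nonneg_nonneg mult_nonneg_nonneg sum_nonneg) auto
  finally show ?thesis .
qed

lemma eigenvalue_minus_class_mat_le:
  assumes "eigenvalue (a \<cdot>\<^sub>m 1\<^sub>m n - class_mat n c) k"
  shows "k \<le> a"
proof -
  let ?M = "class_mat n c"
  have dim: "dim_row (a \<cdot>\<^sub>m 1\<^sub>m n - ?M) = n" by (simp add: class_mat_def)
  from assms obtain v where v: "v \<in> carrier_vec n" "v \<noteq> 0\<^sub>v n"
    and ev: "(a \<cdot>\<^sub>m 1\<^sub>m n - ?M) *\<^sub>v v = k \<cdot>\<^sub>v v"
    unfolding eigenvalue_def eigenvector_def dim by blast
  have "v \<bullet> ((a \<cdot>\<^sub>m 1\<^sub>m n - ?M) *\<^sub>v v) = a * (v \<bullet> v) - v \<bullet> (?M *\<^sub>v v)"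
    using v by (simp add: smult_one_minus_mult_mat_vec[of _ n] scalar_prod_minus_distrib[of _ n]
        mult_mat_vec_carrier[of _ n n])
  then have "k * (v \<bullet> v) \<le> a * (v \<bullet> v)"
    using class_mat_psd[OF v(1), of c] v by (simp add: ev)
  moreover have "0 < v \<bullet> v"
    using v conjugate_square_greater_0_vec[of v n] by simp
  ultimately show ?thesis by simp
qed

text \<open>The matrix factors through the \<open>p\<close> classes: each row of the incidence
  matrix \<open>X\<close> has a single 1, so \<open>X * Y\<close> repeats for index \<open>r\<close>
  the row of \<open>Y\<close> at class \<open>c r\<close>. It remains to see that the
  \<open>p\<close> by \<open>p\<close> product \<open>Y * X\<close> is invertible.\<close>

lemma order_char_poly_minus_class_mat:
  assumes c: "c ` {..<n} = {..<p}"
  shows "Polynomial.order a (char_poly (a \<cdot>\<^sub>m 1\<^sub>m n - class_mat n c)) + p = n"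
proof -
  define X :: "real mat" where "X = mat n p (\<lambda>(r, i). of_bool (c r = i))"
  define Y :: "real mat" where "Y = mat p n (\<lambda>(i, r). 1 + 2 * of_bool (c r = i))"
  define m where "m i = (\<Sum>r<n. of_bool (c r = i) :: real)" for i
  have XY: "X \<in> carrier_mat n p" "Y \<in> carrier_mat p n"
    by (auto simp: X_def Y_def)
  have "class_mat n c = X * Y"
  proof (rule eq_matI)
    fix r t assume "r < dim_row (X * Y)" "t < dim_col (X * Y)"
    then have "r < n" "t < n" using XY by auto
    moreover have "(X * Y) $$ (r, t) = (\<Sum>i<p. of_bool (c r = i) * (1 + 2 * of_bool (c t = i)))"
      using calculation by (simp add: X_def Y_def scalar_prod_def lessThan_atLeast0)
    moreover have "c r < p" using c \<open>r < n\<close> by blast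
    moreover have "(\<Sum>i<p. of_bool (c r = i) * (1 + 2 * of_bool (c t = i))) =
        (\<Sum>i<p. if i = c r then 1 + 2 * of_bool (c t = i) else (0 :: real))"
      by (intro sum.cong) auto
    ultimately show "class_mat n c $$ (r, t) = (X * Y) $$ (r, t)"
      by (auto simp: class_mat_def)
  qed (use XY in \<open>auto simp: class_mat_def\<close>)
  moreover have "det (Y * X) \<noteq> 0"
  proof
    assume "det (Y * X) = 0"
    then obtain v where v: "v \<in> carrier_vec p" "v \<noteq> 0\<^sub>v p" and ker: "Y * X *\<^sub>v v = 0\<^sub>v p"
      using det_0_iff_vec_prod_zero_field[of "Y * X" p] XY by auto
    define s where "s = (\<Sum>j<p. m j * v $ j)"
    have YX: "(Y * X) $$ (i, j) = m j * (1 + 2 * of_bool (i = j))" if "i < p" "j < p" for i j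
    proof -
      have "(Y * X) $$ (i, j) = (\<Sum>r<n. (1 + 2 * of_bool (c r = i)) * of_bool (c r = j))"
        using that by (simp add: X_def Y_def scalar_prod_def lessThan_atLeast0)
      also have "\<dots> = m j * (1 + 2 * of_bool (i = j))"
        unfolding m_def sum_distrib_right by (intro sum.cong) auto
      finally show ?thesis .
    qed
    have row: "s + 2 * (m i * v $ i) = 0" if i: "i < p" for i
    proof -
      have "0 = (Y * X *\<^sub>v v) $ i" using ker i by simp
      also have "\<dots> = (\<Sum>j<p. (Y * X) $$ (i, j) * v $ j)"
        using i XY v by (simp add: scalar_prod_def lessThan_atLeast0 del: assoc_mult_mat_vec)
      also have "\<dots> = (\<Sum>j<p. m j * v $ j + (if j = i then 2 * (m j * v $ j) else 0))"
        using i by (intro sum.cong) (auto simp: YX algebra_simps)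
      also have "\<dots> = s + 2 * (m i * v $ i)"
        using i by (simp add: sum.distrib s_def)
      finally show ?thesis by simp
    qed
    \<comment> \<open>Summing the kernel equations over all classes collects the terms
      \<open>m i * v $ i\<close> into another \<open>2 * s\<close>.\<close>
    have "0 = (\<Sum>i<p. s + 2 * (m i * v $ i))" using row by simp
    also have "\<dots> = (real p + 2) * s"
      by (simp add: sum.distrib sum_distrib_left[symmetric] s_def[symmetric] distrib_right)
    finally have "(real p + 2) * s = 0" by simp
    then have "s = 0" by simp
    \<comment> \<open>\<open>m i\<close> is the size of class \<open>i\<close>, which is positive
      because \<open>c\<close> is onto \<open>{..<p}\<close>.\<close>
    moreover have "m i \<noteq> 0" if i: "i < p" for i
    proof -
      obtain r where "r < n" "c r = i" using c i by (metis imageE lessThan_iff)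
      then show ?thesis unfolding m_def by (subst sum_nonneg_eq_0_iff) auto
    qed
    ultimately have "v = 0\<^sub>v p"
      using row v by (intro eq_vecI) auto
    then show False using v by simp
  qed
  ultimately show ?thesis
    using order_char_poly_minus_mult[OF XY] by simp
qed

text \<open>Since \<open>p < n\<close>, the multiplicity \<open>n - p\<close> of \<open>a\<close> is
  positive, so \<open>a\<close> really occurs in the spectrum; semidefiniteness makes it an upper
  bound.\<close>

lemma largest_eigenvalue_minus_class_mat:
  assumes c: "c ` {..<n} = {..<p}" and "p < n"
  shows "largest_eigenvalue (a \<cdot>\<^sub>m 1\<^sub>m n - class_mat n c) = a"
proof -
  define A where "A = a \<cdot>\<^sub>m 1\<^sub>m n - class_mat n c"
  have A: "A \<in> carrier_mat n n" unfolding A_def by (intro minus_carrier_mat) simp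
  have "Polynomial.order a (char_poly A) \<noteq> 0"
    using order_char_poly_minus_class_mat[OF c, of a] \<open>p < n\<close> by (simp add: A_def)
  then have "poly (char_poly A) a = 0" by (simp add: order_root)
  then have "a \<in> spectrum A" by (simp add: spectrum_root_char_poly[OF A])
  moreover have "k \<le> a" if "k \<in> spectrum A" for k
    using that eigenvalue_minus_class_mat_le by (simp add: spectrum_def A_def)
  ultimately show ?thesis
    unfolding largest_eigenvalue_def A_def[symmetric]
    using card_finite_spectrum(1)[OF A] by (intro Max_eqI)
qed

section \<open>Distances in graphs\<close>

text \<open>Under unit weights the cost of a walk is its length, so a shortest walk attains the
  infimum. Distances are computed through this rule, without extended reals.\<close>

lemma graph_dist_eqI:
  assumes "wf_digraph G" "pre_digraph.awalk G u p v"
    and "\<And>q. pre_digraph.awalk G u q v \<Longrightarrow> length p \<le> length q"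
  shows "graph_dist G u v = length p"
proof -
  interpret wf_digraph G by fact
  have cost: "awalk_cost (\<lambda>_. 1) q = real (length q)" for q :: "'b list"
    by (simp add: awalk_cost_def sum_list_triv)
  have "\<mu> (\<lambda>_. 1) u v = ereal (length p)"
    unfolding \<mu>_def cost using assms(2,3) by (intro INF_eqI) auto
  then show ?thesis by (simp add: graph_dist_def)
qed

lemma (in wf_digraph) obtain_shortest_awalk:
  assumes "u \<rightarrow>\<^sup>* v"
  obtains p where "awalk u p v" "\<And>q. awalk u q v \<Longrightarrow> length p \<le> length q"
    "graph_dist G u v = length p"
proof -
  obtain p0 where "awalk u p0 v" using assms by (auto simp: reachable_awalk)
  then obtain p where "awalk u p v" "\<And>q. awalk u q v \<Longrightarrow> length p \<le> length q"
    using arg_min_nat_lemma[of "\<lambda>p. awalk u p v" p0 length] by blast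
  then show thesis using graph_dist_eqI[OF wf_digraph_axioms] that by blast
qed

context sym_digraph
begin

text \<open>Each arc is replaced by an opposite one, appended at the end of the reversed
  remainder.\<close>

lemma awalk_reverse:
  assumes "awalk u p v"
  shows "\<exists>q. awalk v q u \<and> length q = length p"
  using assms
proof (induction p arbitrary: u)
  case Nil
  then show ?case by (auto simp: awalk_simps)
next
  case (Cons e p)
  then have e: "e \<in> arcs G" "u = tail G e" "awalk (head G e) p v"
    by (auto simp: awalk_simps)
  then obtain q where q: "awalk v q (head G e)" "length q = length p"
    using Cons.IH by blast
  have "(head G e, u) \<in> arcs_ends G"
    using e(1,2) by - (rule graph_symmetric, auto simp: arcs_ends_conv)
  then obtain e' where "e' \<in> arcs G" "tail G e' = head G e" "head G e' = u"
    by (auto simp: arcs_ends_conv)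
  then have "awalk (head G e) [e'] u" by (auto simp: awalk_simps)
  then have "awalk v (q @ [e']) u" using q by (intro awalk_appendI)
  then show ?case using q by (intro exI[of _ "q @ [e']"]) simp
qed

lemma graph_dist_commute:
  assumes "u \<rightarrow>\<^sup>* v"
  shows "graph_dist G v u = graph_dist G u v"
proof -
  obtain p where p: "awalk u p v" "\<And>q. awalk u q v \<Longrightarrow> length p \<le> length q"
    "graph_dist G u v = length p"
    using obtain_shortest_awalk[OF assms] by blast
  obtain p' where p': "awalk v p' u" "length p' = length p"
    using awalk_reverse[OF p(1)] by blast
  have "length p' \<le> length q" if "awalk v q u" for q
    using awalk_reverse[OF that] p(2) p'(2) by metis
  then show ?thesis
    using graph_dist_eqI[OF wf_digraph_axioms p'(1)] p(3) p'(2) by simp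
qed

end

context wf_digraph
begin

lemma graph_dist_self:
  assumes "u \<in> verts G"
  shows "graph_dist G u u = 0"
  using graph_dist_eqI[OF wf_digraph_axioms, of u "[]" u] assms by (simp add: awalk_simps)

lemma length_awalk_ge_1:
  assumes "awalk u p v" "u \<noteq> v"
  shows "1 \<le> length p"
  using assms by (cases p) (auto simp: awalk_simps)

lemma length_awalk_ge_2:
  assumes "awalk u p v" "u \<noteq> v" "(u, v) \<notin> arcs_ends G"
  shows "2 \<le> length p"
proof -
  have "p \<noteq> [e]" for e using assms by (auto simp: awalk_simps arcs_ends_conv)
  moreover have "p \<noteq> []" using assms by (auto simp: awalk_simps)
  \<comment> \<open>The rule serves only to split lists into empty, singleton and longer
    ones.\<close>
  ultimately show ?thesis by (cases p rule: remdups_adj.cases) auto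
qed

lemma graph_dist_adjacent:
  assumes "(u, v) \<in> arcs_ends G" "u \<noteq> v"
  shows "graph_dist G u v = 1"
proof -
  obtain e where "e \<in> arcs G" "tail G e = u" "head G e = v"
    using assms by (auto simp: arcs_ends_conv)
  then have walk: "awalk u [e] v"
    by (auto simp: awalk_simps)
  have "1 \<le> length q" if "awalk u q v" for q
    using length_awalk_ge_1 that assms(2) by blast
  then have "graph_dist G u v = length [e]"
    by (intro graph_dist_eqI[OF wf_digraph_axioms walk]) fastforce
  then show ?thesis by simp
qed

lemma graph_dist_common_neighbour:
  assumes "(u, w) \<in> arcs_ends G" "(w, v) \<in> arcs_ends G" "(u, v) \<notin> arcs_ends G" "u \<noteq> v"
  shows "graph_dist G u v = 2"
proof -
  obtain e f where "e \<in> arcs G" "tail G e = u" "head G e = w"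
    "f \<in> arcs G" "tail G f = w" "head G f = v"
    using assms by (auto simp: arcs_ends_conv)
  then have walk: "awalk u [e, f] v"
    by (auto simp: awalk_simps)
  have "2 \<le> length q" if "awalk u q v" for q
    using length_awalk_ge_2 that assms(3,4) by blast
  then have "graph_dist G u v = length [e, f]"
    by (intro graph_dist_eqI[OF wf_digraph_axioms walk]) fastforce
  then show ?thesis by simp
qed

end

text \<open>Reachability matters: for an unreachable pair the infimum is infinite and its conversion
  to a real number is 0.\<close>

lemma (in sym_digraph) graph_dist_nonadjacent_ge_2:
  assumes "u \<rightarrow>\<^sup>* v" "u \<noteq> v" "(u, v) \<notin> arcs_ends G"
  shows "2 \<le> graph_dist G u v"
proof -
  obtain p where "awalk u p v" "graph_dist G u v = length p"
    using obtain_shortest_awalk[OF assms(1)] by blast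
  then show ?thesis
    using length_awalk_ge_2[of u p v] assms(2,3) by simp
qed

section \<open>Complete multipartite graphs as class maps\<close>

text \<open>The parts are the fibres of \<open>c\<close>, and surjectivity onto
  \<open>{..<q}\<close> says that none is empty. In this form a partition can be fed directly into
  \<open>class_mat\<close>.\<close>

lemma complete_multipartite_iff_class_map:
  assumes "graph G"
  shows "(\<exists>ns. length ns = q \<and> sum_list ns = card (verts G) \<and> (\<forall>m\<in>set ns. 1 \<le> m) \<and>
      complete_multipartite_digraph ns G) \<longleftrightarrow>
    (\<exists>c. c ` verts G = {..<q} \<and>
      (\<forall>u\<in>verts G. \<forall>v\<in>verts G. (u, v) \<in> arcs_ends G \<longleftrightarrow> c u \<noteq> c v))"
    (is "?lhs \<longleftrightarrow> ?rhs")
proof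
  assume ?lhs
  then obtain ns :: "nat list" where ns: "length ns = q" and "complete_multipartite_digraph ns G"
    by blast
  then obtain V where V: "verts G = (\<Union>i<q. V i)" "disjoint_family_on V {..<q}" "\<forall>i<q. V i \<noteq> {}"
    and arcs: "arcs_ends G = {(u, v). \<exists>i<q. \<exists>j<q. i \<noteq> j \<and> u \<in> V i \<and> v \<in> V j}"
    by (auto simp: complete_multipartite_digraph_def)
  have unique: "i = j" if "i < q" "j < q" "u \<in> V i" "u \<in> V j" for i j u
    using V(2) that by (auto simp: disjoint_family_on_def)
  have "\<exists>i. i < q \<and> u \<in> V i" if "u \<in> verts G" for u
    using V(1) that by auto
  then obtain c where c: "\<And>u. u \<in> verts G \<Longrightarrow> c u < q \<and> u \<in> V (c u)"
    by metis
  have c_eq: "c u = i" if "i < q" "u \<in> V i" for u i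
  proof -
    have "u \<in> verts G" using V(1) that by blast
    then show ?thesis using unique[of "c u" i u] c that by simp
  qed
  have "c ` verts G = {..<q}"
  proof
    show "{..<q} \<subseteq> c ` verts G"
    proof
      fix i assume "i \<in> {..<q}"
      then have "i < q" by simp
      moreover from this obtain u where "u \<in> V i" using V(3) by blast
      ultimately have "c u = i" "u \<in> verts G" using c_eq V(1) by auto
      then show "i \<in> c ` verts G" by blast
    qed
  qed (use c in auto)
  moreover have "(u, v) \<in> arcs_ends G \<longleftrightarrow> c u \<noteq> c v" if "u \<in> verts G" "v \<in> verts G" for u v
  proof
    assume "(u, v) \<in> arcs_ends G"
    then obtain i j where "i < q" "j < q" "i \<noteq> j" "u \<in> V i" "v \<in> V j"
      unfolding arcs by blast
    then show "c u \<noteq> c v" using c_eq by metis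
  next
    assume "c u \<noteq> c v"
    then show "(u, v) \<in> arcs_ends G"
      unfolding arcs using c[OF that(1)] c[OF that(2)] by blast
  qed
  ultimately show ?rhs by blast
next
  assume ?rhs
  then obtain c where c: "c ` verts G = {..<q}"
    and adj: "\<And>u v. u \<in> verts G \<Longrightarrow> v \<in> verts G \<Longrightarrow> (u, v) \<in> arcs_ends G \<longleftrightarrow> c u \<noteq> c v"
    by blast
  interpret graph G by fact
  define V where "V i = {u \<in> verts G. c u = i}" for i
  define ns where "ns = map (\<lambda>i. card (V i)) [0..<q]"
  have finite_V: "finite (V i)" for i by (simp add: V_def)
  have V_nonempty: "V i \<noteq> {}" if "i < q" for i
  proof -
    have "i \<in> c ` verts G" using c that by simp
    then show ?thesis by (auto simp: V_def)
  qed
  have verts: "verts G = (\<Union>i<q. V i)"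
    using c by (auto simp: V_def)
  have disj: "disjoint_family_on V {..<q}"
    by (auto simp: disjoint_family_on_def V_def)
  have "sum_list ns = (\<Sum>i<q. card (V i))"
    by (simp add: ns_def interv_sum_list_conv_sum_set_nat lessThan_atLeast0)
  also have "\<dots> = card (verts G)"
    unfolding verts using disj finite_V
    by (subst card_UN_disjoint) (auto simp: disjoint_family_on_def)
  finally have "sum_list ns = card (verts G)" .
  moreover have "\<forall>m\<in>set ns. 1 \<le> m"
    using V_nonempty finite_V by (auto simp: ns_def Suc_le_eq card_gt_0_iff)
  moreover have "arcs_ends G = {(u, v). \<exists>i<q. \<exists>j<q. i \<noteq> j \<and> u \<in> V i \<and> v \<in> V j}"
  proof -
    have "\<exists>i<q. \<exists>j<q. i \<noteq> j \<and> u \<in> V i \<and> v \<in> V j" if "(u, v) \<in> arcs_ends G" for u v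
    proof -
      have uv: "u \<in> verts G" "v \<in> verts G" using that by (auto simp: arcs_ends_conv)
      then have "c u < q" "c v < q" using c by blast+
      then show ?thesis
        using adj[OF uv] that uv by (auto simp: V_def)
    qed
    moreover have "(u, v) \<in> arcs_ends G" if "i \<noteq> j" "u \<in> V i" "v \<in> V j" for u v i j
      using that adj[of u v] by (auto simp: V_def)
    ultimately show ?thesis by blast
  qed
  then have "complete_multipartite_digraph ns G"
    unfolding complete_multipartite_digraph_def using assms verts disj V_nonempty
    by (intro conjI exI[of _ V]) (simp_all add: ns_def)
  ultimately show ?lhs by (intro exI[of _ ns]) (simp add: ns_def)
qed

section \<open>The distance Seidel matrix\<close>

lemma distance_seidel_matrix_carrier [simp]:
  "distance_seidel_matrix G vs \<in> carrier_mat (length vs) (length vs)"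
  unfolding distance_seidel_matrix_def distance_matrix_def
  by (intro minus_carrier_mat smult_carrier_mat) simp

lemma distance_seidel_matrix_index:
  assumes "r < length vs" "t < length vs"
  shows "distance_seidel_matrix G vs $$ (r, t) =
    1 - (if r = t then 1 else 0) - 2 * graph_dist G (vs ! r) (vs ! t)"
  using assms by (simp add: distance_seidel_matrix_def all_ones_mat_def distance_matrix_def)

text \<open>Off the diagonal the entry \<open>1 - 2 d\<close> is -1 across classes and -3 within a
  class; on it, \<open>0 = 3 - 3\<close>. Both directions of the theorem use this.\<close>

lemma (in loopfree_digraph) distance_seidel_matrix_eq_class_mat:
  assumes "distinct vs" "set vs = verts G"
    and adj: "\<And>u v. u \<in> verts G \<Longrightarrow> v \<in> verts G \<Longrightarrow> (u, v) \<in> arcs_ends G \<longleftrightarrow> c u \<noteq> c v"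
    and dist: "\<And>u v. u \<in> verts G \<Longrightarrow> v \<in> verts G \<Longrightarrow> u \<noteq> v \<Longrightarrow> (u, v) \<notin> arcs_ends G \<Longrightarrow>
      graph_dist G u v = 2"
  shows "distance_seidel_matrix G vs = 3 \<cdot>\<^sub>m 1\<^sub>m (length vs) - class_mat (length vs) (\<lambda>r. c (vs ! r))"
    (is "?D = ?C")
proof (rule eq_matI)
  fix r t assume "r < dim_row ?C" "t < dim_col ?C"
  then have rt: "r < length vs" "t < length vs" by (auto simp: class_mat_def)
  then have verts: "vs ! r \<in> verts G" "vs ! t \<in> verts G"
    using assms(2) nth_mem by blast+
  have "graph_dist G (vs ! r) (vs ! t) = (if r = t then 0 else if c (vs ! r) = c (vs ! t) then 2 else 1)"
    using graph_dist_self graph_dist_adjacent adj dist verts rt \<open>distinct vs\<close>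
    by (auto simp: nth_eq_iff_index_eq)
  then show "?D $$ (r, t) = ?C $$ (r, t)"
    using rt by (auto simp: distance_seidel_matrix_index class_mat_def)
qed (auto simp: class_mat_def distance_seidel_matrix_def all_ones_mat_def distance_matrix_def)

lemma image_nth_lessThan_length:
  "(\<lambda>r. c (vs ! r)) ` {..<length vs} = c ` set vs"
  by (auto simp: set_conv_nth)

theorem theorem3p5:
  fixes G :: "('a, 'b) pre_digraph" and vs :: "'a list" and n q :: nat
  assumes "graph G"
    and "Digraph_Component.connected G"
    and "distinct vs" and "set vs = verts G"
    and "length vs = n"
    and "q \<in> {2..n - 1}"
  shows "(largest_eigenvalue (distance_seidel_matrix G vs) = 3 \<and>
          eigenvalue_multiplicity (distance_seidel_matrix G vs) 3 = n - q)
     \<longleftrightarrow> (\<exists>ns. length ns = q \<and> sum_list ns = n \<and> (\<forall>m\<in>set ns. 1 \<le> m) \<and>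
              complete_multipartite_digraph ns G)"
proof -
  interpret graph G by fact
  let ?D = "distance_seidel_matrix G vs"
  let ?E = "arcs_ends G"
  have n: "n = card (verts G)"
    using assms(3-5) distinct_card by fastforce
  have q: "2 \<le> q" "q < n" using assms(6) by auto
  have reach: "u \<rightarrow>\<^sup>*\<^bsub>G\<^esub> v" if "u \<in> verts G" "v \<in> verts G" for u v
    using symmetric_connected_imp_strongly_connected[OF sym_arcs assms(2)] that
    by (auto simp: strongly_connected_def)
  have "(largest_eigenvalue ?D = 3 \<and> eigenvalue_multiplicity ?D 3 = n - q) \<longleftrightarrow>
    (\<exists>c. c ` verts G = {..<q} \<and> (\<forall>u\<in>verts G. \<forall>v\<in>verts G. (u, v) \<in> ?E \<longleftrightarrow> c u \<noteq> c v))"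
    (is "?lhs \<longleftrightarrow> ?rhs")
  proof
    assume ?rhs
    then obtain c where c: "c ` verts G = {..<q}"
      and adj: "\<And>u v. u \<in> verts G \<Longrightarrow> v \<in> verts G \<Longrightarrow> (u, v) \<in> ?E \<longleftrightarrow> c u \<noteq> c v"
      by blast
    have "graph_dist G u v = 2"
      if uv: "u \<in> verts G" "v \<in> verts G" "u \<noteq> v" "(u, v) \<notin> ?E" for u v
    proof -
      \<comment> \<open>As \<open>2 \<le> q\<close>, there is a class other than that of
        \<open>u\<close>. Nonadjacent \<open>u\<close> and \<open>v\<close> share their class, so
        any vertex of the other class is a common neighbour.\<close>
      have "(if c u = 0 then 1 else 0) \<in> c ` verts G"
        using c q by auto
      then obtain w where w: "w \<in> verts G" "c w = (if c u = 0 then 1 else 0)"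
        by force
      then have "c w \<noteq> c u" by simp
      then show ?thesis
        using uv w adj by (intro graph_dist_common_neighbour[of u w v]) auto
    qed
    then have "?D = 3 \<cdot>\<^sub>m 1\<^sub>m n - class_mat n (\<lambda>r. c (vs ! r))"
      using distance_seidel_matrix_eq_class_mat[OF assms(3,4), of c] adj assms(5) by blast
    moreover have classes: "(\<lambda>r. c (vs ! r)) ` {..<n} = {..<q}"
      using image_nth_lessThan_length[of c vs] assms(4,5) c by simp
    ultimately show ?lhs
      using largest_eigenvalue_minus_class_mat[OF classes q(2), of 3]
        order_char_poly_minus_class_mat[OF classes, of 3]
      by (simp add: eigenvalue_multiplicity_def)
  next
    assume ?lhs
    then have max: "largest_eigenvalue ?D = 3" and mult: "eigenvalue_multiplicity ?D 3 = n - q"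
      by auto
    have D: "?D \<in> carrier_mat n n" using assms(5) by auto
    have vs: "vs ! r \<in> verts G" if "r < n" for r
      using that assms(4,5) nth_mem by blast
    have D_sym: "?D\<^sup>T = ?D"
      using D graph_dist_commute[OF reach[OF vs vs]] assms(5)
      by (intro eq_matI) (auto simp: distance_seidel_matrix_index)
    define M where "M = 3 \<cdot>\<^sub>m 1\<^sub>m n - ?D"
    have M: "M \<in> carrier_mat n n" "M\<^sup>T = M"
      using D transpose_mat_symmetric_entry[OF D_sym] by (auto simp: M_def intro!: eq_matI)
    have psd: "0 \<le> v \<bullet> (M *\<^sub>v v)" if v: "v \<in> carrier_vec n" for v
      using largest_eigenvalue_rayleigh[OF D D_sym v] v D max
      by (simp add: M_def smult_one_minus_mult_mat_vec[of _ n] scalar_prod_minus_distrib[of _ n]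
          mult_mat_vec_carrier[of _ n n])
    have entry: "M $$ (r, t) = (if r = t then 3 else 2 * graph_dist G (vs ! r) (vs ! t) - 1)"
      if "r < n" "t < n" for r t
      using that D assms(5) graph_dist_self[OF vs[OF that(1)]]
      by (auto simp: M_def distance_seidel_matrix_index)
    have dist: "graph_dist G (vs ! r) (vs ! t) = 2"
      if rt: "r < n" "t < n" "vs ! r \<noteq> vs ! t" "(vs ! r, vs ! t) \<notin> ?E" for r t
    proof -
      \<comment> \<open>The entry is \<open>2 d - 1\<close>, so this bounds the distance by 2, and
        nonadjacency gives the opposite inequality.\<close>
      have "M $$ (t, r) \<le> 3"
        using psd_offdiag_le[OF M psd rt(1,2)] entry rt by simp
      then have "graph_dist G (vs ! t) (vs ! r) \<le> 2"
        using entry[OF rt(2,1)] rt(3) by (auto split: if_splits)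
      then show ?thesis
        using graph_dist_nonadjacent_ge_2[OF reach[OF vs[OF rt(1)] vs[OF rt(2)]] rt(3,4)]
          graph_dist_commute[OF reach[OF vs[OF rt(1)] vs[OF rt(2)]]] by simp
    qed
    \<comment> \<open>\<open>M\<close> thus records exactly the adjacency relation; the diagonal
      fits because there are no loops.\<close>
    have entry': "M $$ (r, t) = (if (vs ! r, vs ! t) \<in> ?E then 1 else 3)"
      if rt: "r < n" "t < n" for r t
    proof (cases "r = t")
      case True
      then show ?thesis using entry rt adj_not_same by auto
    next
      case False
      then have "vs ! r \<noteq> vs ! t"
        using rt assms(3,5) by (simp add: nth_eq_iff_index_eq)
      then show ?thesis
        using False entry[OF rt] dist[OF rt] graph_dist_adjacent by auto
    qed
    have nbrs: "(w, u) \<in> ?E \<longleftrightarrow> (w, v) \<in> ?E"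
      if uvw: "u \<in> verts G" "v \<in> verts G" "w \<in> verts G" "(u, v) \<notin> ?E" for u v w
    proof -
      obtain r s t where rst: "r < n" "s < n" "t < n" "vs ! r = u" "vs ! s = w" "vs ! t = v"
        using uvw(1-3) assms(4,5) by (metis in_set_conv_nth)
      have "(v, u) \<notin> ?E" using uvw(4) graph_symmetric by blast
      \<comment> \<open>A nonadjacent pair has entry 3, the mean of its diagonal entries, so the
        equality case applies and the columns of \<open>u\<close> and \<open>v\<close> agree in row
        \<open>s\<close>.\<close>
      then have "2 * M $$ (t, r) = M $$ (r, r) + M $$ (t, t)"
        using rst entry[of r r] entry[of t t] by (simp add: entry'[of t r])
      then have "M $$ (s, r) = M $$ (s, t)"
        using psd_offdiag_eq_imp_equal_columns[OF M psd] rst by blast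
      then show ?thesis
        using rst by (simp add: entry' split: if_splits)
    qed
    \<comment> \<open>Nonadjacency will turn out to be equality of neighbourhoods, hence an
      equivalence relation whose classes are the parts.\<close>
    define N where "N u = {v \<in> verts G. (u, v) \<in> ?E}" for u
    have N_eq: "(u, v) \<in> ?E \<longleftrightarrow> N u \<noteq> N v" if uv: "u \<in> verts G" "v \<in> verts G" for u v
    proof
      assume "(u, v) \<in> ?E"
      moreover have "(v, v) \<notin> ?E" using adj_not_same by blast
      ultimately show "N u \<noteq> N v" using uv by (auto simp: N_def)
    next
      assume "N u \<noteq> N v"
      then obtain w where w: "w \<in> verts G" and "(u, w) \<in> ?E \<longleftrightarrow> (v, w) \<notin> ?E"
        by (auto simp: N_def)
      then have "(w, u) \<in> ?E \<longleftrightarrow> (w, v) \<notin> ?E"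
        using graph_symmetric by blast
      then show "(u, v) \<in> ?E" using nbrs[OF uv w] by blast
    qed
    define p where "p = card (N ` verts G)"
    \<comment> \<open>Numbering the \<open>p\<close> distinct neighbourhoods turns \<open>N\<close>
      into a class map onto \<open>{..<p}\<close>.\<close>
    obtain g where g: "bij_betw g (N ` verts G) {..<p}"
      using ex_bij_betw_finite_nat[of "N ` verts G"] by (auto simp: p_def lessThan_atLeast0)
    define c where "c = g \<circ> N"
    have c: "c ` verts G = {..<p}"
      using g by (auto simp: c_def bij_betw_def)
    have adj: "(u, v) \<in> ?E \<longleftrightarrow> c u \<noteq> c v" if "u \<in> verts G" "v \<in> verts G" for u v
      using N_eq[OF that] g that by (auto simp: c_def bij_betw_def inj_on_def)
    have "graph_dist G u v = 2"
      if uv: "u \<in> verts G" "v \<in> verts G" "u \<noteq> v" "(u, v) \<notin> ?E" for u v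
      using uv dist assms(4,5) by (metis in_set_conv_nth)
    then have "?D = 3 \<cdot>\<^sub>m 1\<^sub>m n - class_mat n (\<lambda>r. c (vs ! r))"
      using distance_seidel_matrix_eq_class_mat[OF assms(3,4), of c] adj assms(5) by blast
    moreover have classes: "(\<lambda>r. c (vs ! r)) ` {..<n} = {..<p}"
      using image_nth_lessThan_length[of c vs] assms(4,5) c by simp
    ultimately have "eigenvalue_multiplicity ?D 3 + p = n"
      using order_char_poly_minus_class_mat[OF classes, of 3]
      by (simp add: eigenvalue_multiplicity_def)
    \<comment> \<open>The truncated difference \<open>n - q\<close> is a true one because
      \<open>q < n\<close>, so it determines \<open>p\<close>.\<close>
    then have "p = q" using mult q by simp
    then show ?rhs using c adj by blast
  qed
  then show ?thesis
    using complete_multipartite_iff_class_map[OF assms(1)] n by simp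
qed

end
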